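(* Let $n\ge 2$ and let $m_1<\cdots<m_n$ be an arithmetic sequence of positive integers, i.e. $m_i=m_1+(i-1)d$ for all $i\in\{1,\ldots,n\}$ with $d\in\mathbb{Z}^+$, and suppose $\gcd\{m_1,d\}=1$. Let $q\in\mathbb{N}$ and $r\in\{1,\ldots,n-1\}$ be such that $m_1=q(n-1)+r$, and set $\alpha:=q+d$ and $k:=n-r$. Then the Hilbert function of $K[\mathcal{C}]$ is $$HF_{K[\mathcal{C}]}(s)=\begin{cases}\binom{s+2}{2}+(n-2)\binom{s+1}{2}&\text{if }0\le s<\alpha,\\[2pt] m_n\,s+\alpha(2-n+k)-\binom{\alpha+1}{2}-(n-2)\binom{\alpha}{2}+1&\text{if }s\ge\alpha.\end{cases}$$
   Context: $K$ is an infinite field, $R=K[x_1,\ldots,x_{n+1}]$ with its standard grading, and $0\in\mathbb{N}$. For positive integers $m_1<\cdots<m_n$, the associated projective monomial curve $\mathcal{C}\subset\mathbb{P}^n_K$ is parametrically defined by $x_i=u^{m_i}v^{m_n-m_i}$ for $1\le i\le n$ and $x_{n+1}=v^{m_n}$. Its vanishing ideal $I(\mathcal{C})\subset R$ is the kernel of the $K$-algebra homomorphism $R\to K[u,v]$, $x_i\mapsto u^{m_i}v^{m_n-m_i}$ ($1\le i\le n$), $x_{n+1}\mapsto v^{m_n}$ (a homogeneous ideal), and $K[\mathcal{C}]=R/I(\mathcal{C})$. The Hilbert function is $HF_{K[\mathcal{C}]}(s)=\dim_K(R_s/(I(\mathcal{C})\cap R_s))$ for $s\in\mathbb{N}$,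 where $R_s$ is the space of homogeneous polynomials of degree $s$. *)

theory Defs
  imports "Jordan_Normal_Form.VS_Connect" "HOL-Algebra.AbelCoset" "HOL-Library.Poly_Mapping"
begin

section \<open>Multivariate polynomials\<close>

text \<open>Polynomials over \<open>'k\<close> with variables indexed by \<open>'v\<close>: finitely supported maps from
  monomials (finitely supported exponent maps) to coefficients. The ring operations are those
  of \<^theory>\<open>HOL-Library.Poly_Mapping\<close>.\<close>

type_synonym ('v, 'k) mpoly = "('v \<Rightarrow>\<^sub>0 nat) \<Rightarrow>\<^sub>0 'k"

definition Const :: "'k::comm_ring_1 \<Rightarrow> ('v, 'k) mpoly" where
  "Const c = Poly_Mapping.single 0 c"

definition Var :: "'v \<Rightarrow> ('v, 'k::comm_ring_1) mpoly" where
  "Var i = Poly_Mapping.single (Poly_Mapping.single i 1) 1"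

definition monom_degree :: "('v \<Rightarrow>\<^sub>0 nat) \<Rightarrow> nat" where
  "monom_degree t = (\<Sum>i\<in>Poly_Mapping.keys t. Poly_Mapping.lookup t i)"

text \<open>The \<open>'k\<close>-algebra homomorphism sending \<open>Var i\<close> to \<open>f i\<close>.\<close>

definition subst_vars :: "('v \<Rightarrow> ('w, 'k) mpoly) \<Rightarrow> ('v, 'k::comm_ring_1) mpoly \<Rightarrow> ('w, 'k) mpoly" where
  "subst_vars f p = (\<Sum>t\<in>Poly_Mapping.keys p. Const (Poly_Mapping.lookup p t) *
     (\<Prod>i\<in>Poly_Mapping.keys t. f i ^ Poly_Mapping.lookup t i))"

lemma Const_zero [simp]: "Const 0 = 0"
  and Const_one [simp]: "Const 1 = 1"
  and Const_add: "Const (a + b) = Const a + Const b"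
  and Const_mult: "Const (a * b) = Const a * Const b"
  by (simp_all add: Const_def single_add mult_single)

lemma mpoly_induct [case_names zero single add]:
  fixes p :: "('v, 'k::comm_ring_1) mpoly"
  assumes "P 0" "\<And>t c. P (Poly_Mapping.single t c)" "\<And>p q. P p \<Longrightarrow> P q \<Longrightarrow> P (p + q)"
  shows "P p"
proof (induction p rule: update_induct)
  case (update p t c)
  have "Poly_Mapping.update t c p = p + Poly_Mapping.single t c"
    using update(1)
    by (intro poly_mapping_eqI) (auto simp: lookup_update lookup_add lookup_single in_keys_iff)
  with update assms show ?case by simp
qed (use assms in simp)

lemma subst_vars_superset:
  assumes "finite A" "Poly_Mapping.keys p \<subseteq> A"
  shows "subst_vars f p = (\<Sum>t\<in>A. Const (Poly_Mapping.lookup p t) *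
     (\<Prod>i\<in>Poly_Mapping.keys t. f i ^ Poly_Mapping.lookup t i))"
  unfolding subst_vars_def using assms
  by (intro sum.mono_neutral_left) (auto simp: in_keys_iff)

lemma subst_vars_zero [simp]: "subst_vars f 0 = 0"
  by (simp add: subst_vars_def)

lemma subst_vars_add: "subst_vars f (p + q) = subst_vars f p + subst_vars f q"
proof -
  let ?A = "Poly_Mapping.keys p \<union> Poly_Mapping.keys q"
  have "Poly_Mapping.keys (p + q) \<subseteq> ?A" by (rule keys_add)
  then show ?thesis
    by (simp add: subst_vars_superset[of ?A] lookup_add Const_add distrib_right sum.distrib)
qed

lemma subst_vars_single: "subst_vars f (Poly_Mapping.single t c) =
    Const c * (\<Prod>i\<in>Poly_Mapping.keys t. f i ^ Poly_Mapping.lookup t i)"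
  by (simp add: subst_vars_superset[of "{t}"])

lemma subst_vars_Const [simp]: "subst_vars f (Const c) = Const c"
  by (simp add: Const_def subst_vars_single)

lemma subst_vars_one [simp]: "subst_vars f 1 = 1"
  using subst_vars_Const[of f 1] by simp

lemma subst_vars_Var [simp]: "subst_vars f (Var i) = f i"
  by (simp add: Var_def subst_vars_single)

lemma subst_vars_mult: "subst_vars f (p * q) = subst_vars f p * subst_vars f q"
proof -
  have mon: "(\<Prod>i\<in>Poly_Mapping.keys (s + t). f i ^ Poly_Mapping.lookup (s + t) i) =
      (\<Prod>i\<in>Poly_Mapping.keys s. f i ^ Poly_Mapping.lookup s i) *
      (\<Prod>i\<in>Poly_Mapping.keys t. f i ^ Poly_Mapping.lookup t i)" for s t
  proof -
    let ?A = "Poly_Mapping.keys s \<union> Poly_Mapping.keys t"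
    have *: "(\<Prod>i\<in>Poly_Mapping.keys u. f i ^ Poly_Mapping.lookup u i) =
        (\<Prod>i\<in>?A. f i ^ Poly_Mapping.lookup u i)" if "Poly_Mapping.keys u \<subseteq> ?A" for u
      using that by (intro prod.mono_neutral_left) (auto simp: in_keys_iff)
    show ?thesis
      using *[of s] *[of t] *[OF keys_add]
      by (simp add: lookup_add power_add prod.distrib)
  qed
  have single: "subst_vars f (Poly_Mapping.single t c * q) =
      subst_vars f (Poly_Mapping.single t c) * subst_vars f q" for t c
    by (induction q rule: mpoly_induct)
      (simp_all add: mult_single subst_vars_single subst_vars_add algebra_simps mon Const_mult)
  show ?thesis
    by (induction p rule: mpoly_induct)
      (simp_all add: single subst_vars_add distrib_right)
qed

text \<open>The ring $K[x_1,\ldots,x_{n+1}]$: polynomials in which only the variables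
  with index in \<open>{1..n+1}\<close> occur.\<close>

definition poly_ring :: "nat \<Rightarrow> (nat, 'k::comm_ring_1) mpoly set" where
  "poly_ring n = {p. \<forall>t\<in>Poly_Mapping.keys p. Poly_Mapping.keys t \<subseteq> {1..n+1}}"

definition homogeneous_part :: "nat \<Rightarrow> nat \<Rightarrow> (nat, 'k::comm_ring_1) mpoly set" where
  "homogeneous_part n s = {p \<in> poly_ring n. \<forall>t\<in>Poly_Mapping.keys p. monom_degree t = s}"

text \<open>Polynomials as a module over the coefficients. The \<open>module\<close> locale does not look at the
  fields \<open>mult\<close> and \<open>one\<close>.\<close>

definition mpoly_module :: "('k::comm_ring_1, ('v, 'k) mpoly) module" where
  "mpoly_module = \<lparr>carrier = UNIV, mult = (*), one = 1, zero = 0, add = (+),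
     smult = (\<lambda>c p. Const c * p)\<rparr>"


section \<open>Quotients of modules\<close>

text \<open>In the scalar multiplication the product set is saturated again by \<open>N\<close>, as
  \<open>{c \<odot> a | a \<in> A}\<close> is in general not a coset (take \<open>c = 0\<close>).\<close>

definition quotient_module ::
    "('a, 'b, 'c) module_scheme \<Rightarrow> 'b set \<Rightarrow> ('a, 'b set) module" where
  "quotient_module M N = \<lparr>carrier = a_rcosets\<^bsub>M\<^esub> N, mult = undefined, one = undefined,
     zero = N, add = set_add M,
     smult = (\<lambda>c A. \<Union>a\<in>A. N +>\<^bsub>M\<^esub> (c \<odot>\<^bsub>M\<^esub> a))\<rparr>"

lemma quotient_module_smult_coset:
  assumes M: "Module.module K M" and N: "Module.submodule N K M"
    and c: "c \<in> carrier K" and a: "a \<in> carrier M"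
  shows "c \<odot>\<^bsub>quotient_module M N\<^esub> (N +>\<^bsub>M\<^esub> a) = N +>\<^bsub>M\<^esub> (c \<odot>\<^bsub>M\<^esub> a)"
proof -
  interpret M: Module.module K M by fact
  interpret N: Module.submodule N K M by fact
  interpret abelian_subgroup N M
    by (rule abelian_subgroupI3) (use N.subgroup_axioms M.abelian_group_axioms
      in \<open>auto simp: additive_subgroup_def\<close>)
  have *: "N +>\<^bsub>M\<^esub> (c \<odot>\<^bsub>M\<^esub> x) = N +>\<^bsub>M\<^esub> (c \<odot>\<^bsub>M\<^esub> a)" if "x \<in> N +>\<^bsub>M\<^esub> a" for x
  proof -
    obtain h where h: "h \<in> N" "x = h \<oplus>\<^bsub>M\<^esub> a" using \<open>x \<in> N +>\<^bsub>M\<^esub> a\<close> by (auto simp: a_r_coset_def')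
    have "c \<odot>\<^bsub>M\<^esub> x = (c \<odot>\<^bsub>M\<^esub> h) \<oplus>\<^bsub>M\<^esub> (c \<odot>\<^bsub>M\<^esub> a)"
      using h c a by (simp add: M.smult_r_distr)
    moreover have "c \<odot>\<^bsub>M\<^esub> h \<in> N" using h c by (simp add: N.smult_closed)
    ultimately have "c \<odot>\<^bsub>M\<^esub> x \<in> N +>\<^bsub>M\<^esub> (c \<odot>\<^bsub>M\<^esub> a)" by (auto simp: a_r_coset_def')
    then show ?thesis using a_repr_independence'[of "c \<odot>\<^bsub>M\<^esub> x"] c a by auto
  qed
  have "a \<in> N +>\<^bsub>M\<^esub> a" using a by (rule a_rcos_self)
  then have "(\<Union>x\<in>N +>\<^bsub>M\<^esub> a. N +>\<^bsub>M\<^esub> (c \<odot>\<^bsub>M\<^esub> x)) = N +>\<^bsub>M\<^esub> (c \<odot>\<^bsub>M\<^esub> a)"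
    using * by blast
  then show ?thesis by (simp add: quotient_module_def)
qed

lemma quotient_module_is_module:
  assumes M: "Module.module K M" and N: "Module.submodule N K M"
  shows "Module.module K (quotient_module M N)"
proof -
  interpret M: Module.module K M by fact
  interpret N: Module.submodule N K M by fact
  interpret abelian_subgroup N M
    by (rule abelian_subgroupI3) (use N.subgroup_axioms M.abelian_group_axioms
      in \<open>auto simp: additive_subgroup_def\<close>)
  let ?Q = "quotient_module M N"
  have carr: "carrier ?Q = {N +>\<^bsub>M\<^esub> x | x. x \<in> carrier M}"
    by (auto simp: quotient_module_def A_RCOSETS_def')
  have add: "(N +>\<^bsub>M\<^esub> x) \<oplus>\<^bsub>?Q\<^esub> (N +>\<^bsub>M\<^esub> y) = N +>\<^bsub>M\<^esub> (x \<oplus>\<^bsub>M\<^esub> y)"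
    if "x \<in> carrier M" "y \<in> carrier M" for x y
    using that by (simp add: quotient_module_def a_rcos_sum)
  note sm = quotient_module_smult_coset[OF M N]
  have zero: "\<zero>\<^bsub>?Q\<^esub> = N +>\<^bsub>M\<^esub> \<zero>\<^bsub>M\<^esub>"
    using a_subset by (simp add: quotient_module_def)
  have ab: "abelian_group ?Q"
  proof (rule abelian_groupI)
    fix x assume "x \<in> carrier ?Q"
    then obtain a where a: "a \<in> carrier M" "x = N +>\<^bsub>M\<^esub> a" by (auto simp: carr)
    have "N +>\<^bsub>M\<^esub> (\<ominus>\<^bsub>M\<^esub> a) \<in> carrier ?Q \<and> (N +>\<^bsub>M\<^esub> (\<ominus>\<^bsub>M\<^esub> a)) \<oplus>\<^bsub>?Q\<^esub> x = \<zero>\<^bsub>?Q\<^esub>"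
      using a by (auto simp: carr zero add M.l_neg)
    then show "\<exists>y\<in>carrier ?Q. y \<oplus>\<^bsub>?Q\<^esub> x = \<zero>\<^bsub>?Q\<^esub>" by blast
  next
    show "\<zero>\<^bsub>?Q\<^esub> \<in> carrier ?Q" unfolding carr zero by blast
  next
    fix x y assume "x \<in> carrier ?Q" "y \<in> carrier ?Q"
    then obtain a b where ab: "a \<in> carrier M" "b \<in> carrier M" "x = N +>\<^bsub>M\<^esub> a" "y = N +>\<^bsub>M\<^esub> b"
      unfolding carr by blast
    then show "x \<oplus>\<^bsub>?Q\<^esub> y = y \<oplus>\<^bsub>?Q\<^esub> x" by (simp add: add M.a_comm)
    have "a \<oplus>\<^bsub>M\<^esub> b \<in> carrier M" using ab by simp
    with ab show "x \<oplus>\<^bsub>?Q\<^esub> y \<in> carrier ?Q" unfolding carr by (auto simp: add)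
  next
    fix x y z assume "x \<in> carrier ?Q" "y \<in> carrier ?Q" "z \<in> carrier ?Q"
    then obtain a b c where "a \<in> carrier M" "b \<in> carrier M" "c \<in> carrier M"
        "x = N +>\<^bsub>M\<^esub> a" "y = N +>\<^bsub>M\<^esub> b" "z = N +>\<^bsub>M\<^esub> c"
      unfolding carr by blast
    then show "(x \<oplus>\<^bsub>?Q\<^esub> y) \<oplus>\<^bsub>?Q\<^esub> z = x \<oplus>\<^bsub>?Q\<^esub> (y \<oplus>\<^bsub>?Q\<^esub> z)" by (simp add: add M.a_assoc)
  next
    fix x assume "x \<in> carrier ?Q"
    then obtain a where "a \<in> carrier M" "x = N +>\<^bsub>M\<^esub> a" unfolding carr by blast
    then show "\<zero>\<^bsub>?Q\<^esub> \<oplus>\<^bsub>?Q\<^esub> x = x" by (simp only: zero) (simp add: add)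
  qed
  show ?thesis
  proof (rule moduleI[OF M.R.is_cring ab])
    fix c x assume "c \<in> carrier K" "x \<in> carrier ?Q"
    then show "c \<odot>\<^bsub>?Q\<^esub> x \<in> carrier ?Q" unfolding carr by (auto simp: sm)
  qed (auto simp: carr add sm M.smult_l_distr M.smult_r_distr M.smult_assoc1)
qed


section \<open>Hilbert functions and projective monomial curves\<close>

text \<open>For a homogeneous ideal \<open>I\<close> of \<open>poly_ring n\<close>: the dimension over \<open>'k\<close> of
  $R_s/(I \cap R_s)$.\<close>

definition hilbert_function :: "nat \<Rightarrow> (nat, 'k::field) mpoly set \<Rightarrow> nat \<Rightarrow> nat" where
  "hilbert_function n I s =
     vectorspace.dim (class_ring :: 'k ring)
       (quotient_module (mpoly_module\<lparr>carrier := homogeneous_part n s\<rparr>)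
                        (I \<inter> homogeneous_part n s))"

datatype param = U | V

text \<open>The parametrization of the curve, with target $K[u,v]$. It is meant for
  \<open>m 1 < \<dots> < m n\<close>, so that the natural number subtraction does not truncate.\<close>

definition curve_param :: "nat \<Rightarrow> (nat \<Rightarrow> nat) \<Rightarrow> nat \<Rightarrow> (param, 'k::comm_ring_1) mpoly" where
  "curve_param n m i =
     (if i \<le> n then Var U ^ m i * Var V ^ (m n - m i) else Var V ^ m n)"

definition curve_ideal :: "nat \<Rightarrow> (nat \<Rightarrow> nat) \<Rightarrow> (nat, 'k::comm_ring_1) mpoly set" where
  "curve_ideal n m = {p \<in> poly_ring n. subst_vars (curve_param n m) p = 0}"

text \<open>The quotient taken in the Hilbert function of the curve is indeed a vector space.\<close>

lemma mpoly_module_is_module: "Module.module class_ring (mpoly_module :: ('k::comm_ring_1, ('v, 'k) mpoly) module)"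
proof (rule moduleI)
  show "cring (class_ring :: 'k ring)" by unfold_locales
  show "abelian_group (mpoly_module :: ('k, ('v, 'k) mpoly) module)"
  proof (rule abelian_groupI)
    fix x :: "('v, 'k) mpoly"
    show "\<exists>y\<in>carrier mpoly_module. y \<oplus>\<^bsub>mpoly_module\<^esub> x = \<zero>\<^bsub>mpoly_module\<^esub>"
      by (rule bexI[of _ "- x"]) (auto simp: mpoly_module_def)
  qed (auto simp: mpoly_module_def add_ac)
qed (auto simp: mpoly_module_def Const_add Const_mult algebra_simps)

lemma mpoly_submoduleI:
  fixes H :: "('v, 'k::comm_ring_1) mpoly set"
  assumes H: "0 \<in> H" "\<And>p q. p \<in> H \<Longrightarrow> q \<in> H \<Longrightarrow> p + q \<in> H" "\<And>c p. p \<in> H \<Longrightarrow> Const c * p \<in> H"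
    and C: "H \<subseteq> C" "Module.module class_ring (mpoly_module\<lparr>carrier := C\<rparr>)"
  shows "Module.submodule H class_ring (mpoly_module\<lparr>carrier := C\<rparr>)"
proof -
  interpret Module.module class_ring "mpoly_module\<lparr>carrier := C\<rparr>" by (rule C(2))
  have neg: "- p \<in> H" if "p \<in> H" for p
  proof -
    have "Const (- 1) * p + p = (Const (- 1) + Const 1) * p" by (simp add: distrib_right)
    also have "\<dots> = 0" by (simp only: Const_add[symmetric]) simp
    finally have "Const (- 1) * p = - p" by (simp add: eq_neg_iff_add_eq_0)
    then show ?thesis using H(3)[OF that, of "- 1"] by simp
  qed
  have "\<ominus>\<^bsub>mpoly_module\<lparr>carrier := C\<rparr>\<^esub> p = - p" if "p \<in> H" for p
    by (rule minus_equality) (use that neg C in \<open>auto simp: mpoly_module_def\<close>)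
  then show ?thesis
    by (intro submoduleI) (use H C neg in \<open>auto simp: mpoly_module_def\<close>)
qed

lemma keys_Const_mult: "Poly_Mapping.keys (Const c * p) \<subseteq> Poly_Mapping.keys p"
  using keys_mult[of "Const c" p] by (auto simp: Const_def split: if_splits)

lemma curve_quotient_vectorspace:
  fixes m :: "nat \<Rightarrow> nat"
  shows "vectorspace (class_ring :: 'k::field ring)
    (quotient_module (mpoly_module\<lparr>carrier := homogeneous_part n s\<rparr>)
                     ((curve_ideal n m :: (nat, 'k) mpoly set) \<inter> homogeneous_part n s))"
proof -
  have R_closed: "0 \<in> homogeneous_part n s"
      "p \<in> homogeneous_part n s \<Longrightarrow> q \<in> homogeneous_part n s \<Longrightarrow> p + q \<in> homogeneous_part n s"
      "p \<in> homogeneous_part n s \<Longrightarrow> Const c * p \<in> homogeneous_part n s"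
    for p q :: "(nat, 'k) mpoly" and c
    using keys_add[of p q] keys_Const_mult[of c p]
    by (simp_all add: homogeneous_part_def poly_ring_def) blast+
  have I_closed: "0 \<in> curve_ideal n m"
      "p \<in> curve_ideal n m \<Longrightarrow> q \<in> curve_ideal n m \<Longrightarrow> p + q \<in> curve_ideal n m"
      "p \<in> curve_ideal n m \<Longrightarrow> Const c * p \<in> curve_ideal n m"
    for p q :: "(nat, 'k) mpoly" and c
    using keys_add[of p q] keys_Const_mult[of c p]
    by (simp_all add: curve_ideal_def poly_ring_def subst_vars_add subst_vars_mult) blast+
  have M: "Module.module class_ring (mpoly_module\<lparr>carrier := UNIV :: (nat, 'k) mpoly set\<rparr>)"
    using mpoly_module_is_module[where ?'v = nat and ?'k = 'k] by (simp add: mpoly_module_def)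
  have "Module.submodule (homogeneous_part n s :: (nat, 'k) mpoly set) class_ring
      (mpoly_module\<lparr>carrier := UNIV\<rparr>)"
    by (rule mpoly_submoduleI) (use M R_closed in auto)
  from Module.submodule.submodule_is_module[OF this M]
  have R: "Module.module class_ring
      (mpoly_module\<lparr>carrier := homogeneous_part n s :: (nat, 'k) mpoly set\<rparr>)"
    by simp
  have "Module.submodule ((curve_ideal n m :: (nat, 'k) mpoly set) \<inter> homogeneous_part n s) class_ring
      (mpoly_module\<lparr>carrier := homogeneous_part n s\<rparr>)"
    by (rule mpoly_submoduleI) (use R R_closed I_closed in auto)
  from quotient_module_is_module[OF R this] show ?thesis
    by (rule vectorspace.intro) (rule class_field)
qed

end

theory Submission
  imports Defs
begin

text \<open>The parametrization sends a monomial of degree \<open>s\<close> to \<open>u\<^sup>w v\<^bsup>s m - w\<^esup>\<close> with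
  \<open>m = m\<^sub>n\<close>, where \<open>w\<close> is a sum of \<open>s\<close> elements of \<open>{0, m\<^sub>1, \<dots>, m\<^sub>n}\<close>. By the first isomorphism
  theorem the Hilbert function at \<open>s\<close> is therefore the size of the \<open>s\<close>-fold sumset of this set,
  which consists of the numbers \<open>j m\<^sub>1 + i d\<close> with \<open>j \<le> s\<close> and \<open>i \<le> j (n - 1)\<close>. Passing from
  \<open>s\<close> to \<open>s + 1\<close> adds the numbers with \<open>j = s + 1\<close>; these are all new while \<open>s < \<alpha>\<close>, and exactly
  \<open>m\<^sub>n\<close> of them are new from then on.\<close>

section \<open>Dimensions of quotients and of spaces of polynomials\<close>

text \<open>The first isomorphism theorem. The isomorphism runs from \<open>W\<close> to the
  quotient, sending \<open>w\<close> to the coset of a preimage, because \<open>dim_eq\<close> asks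
  for finite dimension of the source and this is assumed for \<open>W\<close>.\<close>

lemma (in linear_map) dim_quotient_ker:
  assumes fin: "W.fin_dim" and surj: "T ` carrier V = carrier W"
  shows "vectorspace.dim K (quotient_module V mod_hom.ker) = W.dim"
proof -
  let ?N = "mod_hom.ker"
  let ?Q = "quotient_module V ?N"
  have M: "Module.module K V" by unfold_locales
  have N: "Module.submodule ?N K V"
    by (rule Module.module.submoduleI[OF M]) (auto simp: mod_hom.ker_def)
  interpret N: Module.submodule ?N K V by (rule N)
  interpret abelian_subgroup ?N V
    by (rule abelian_subgroupI3) (use N.subgroup_axioms Module.module.axioms(2)[OF M]
      in \<open>auto simp: additive_subgroup_def\<close>)
  have carr: "carrier ?Q = {?N +>\<^bsub>V\<^esub> x | x. x \<in> carrier V}"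
    by (auto simp: quotient_module_def A_RCOSETS_def')
  have eq_iff: "?N +>\<^bsub>V\<^esub> x = ?N +>\<^bsub>V\<^esub> y \<longleftrightarrow> T x = T y"
    if xy: "x \<in> carrier V" "y \<in> carrier V" for x y
  proof -
    have "?N +>\<^bsub>V\<^esub> x = ?N +>\<^bsub>V\<^esub> y \<longleftrightarrow> x \<in> ?N +>\<^bsub>V\<^esub> y"
    proof
      assume "?N +>\<^bsub>V\<^esub> x = ?N +>\<^bsub>V\<^esub> y"
      then show "x \<in> ?N +>\<^bsub>V\<^esub> y" using a_rcos_self[OF xy(1)] by (simp only:)
    next
      assume "x \<in> ?N +>\<^bsub>V\<^esub> y"
      from a_repr_independence'[OF this xy(2)]
      show "?N +>\<^bsub>V\<^esub> x = ?N +>\<^bsub>V\<^esub> y" by (simp only:)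
    qed
    also have "\<dots> \<longleftrightarrow> x \<oplus>\<^bsub>V\<^esub> \<ominus>\<^bsub>V\<^esub> y \<in> ?N"
      by (rule a_rcos_module[OF xy(2,1)])
    also have "\<dots> \<longleftrightarrow> T x = T y"
    proof -
      have V: "abelian_group V" and W: "abelian_group W"
        by unfold_locales
      note neg = abelian_group.a_inv_closed[OF V] abelian_group.a_inv_closed[OF W]
      have "T (x \<oplus>\<^bsub>V\<^esub> \<ominus>\<^bsub>V\<^esub> y) = T x \<oplus>\<^bsub>W\<^esub> \<ominus>\<^bsub>W\<^esub> T y"
        using xy neg(1) T_add T_neg by metis
      moreover have "T x \<oplus>\<^bsub>W\<^esub> \<ominus>\<^bsub>W\<^esub> T y = \<zero>\<^bsub>W\<^esub> \<longleftrightarrow> T x = T y"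
        using xy T_im neg(2) abelian_group.minus_equality[OF W] abelian_group.minus_minus[OF W]
          abelian_group.r_neg[OF W] by metis
      moreover have "x \<oplus>\<^bsub>V\<^esub> \<ominus>\<^bsub>V\<^esub> y \<in> carrier V"
        using xy by (intro abelian_monoid.a_closed[OF abelian_group.axioms(1)[OF V]] neg)
      ultimately show ?thesis by (simp only: ker_def mem_Collect_eq simp_thms)
    qed
    finally show ?thesis .
  qed
  \<comment> \<open>A section of \<open>T\<close>, in general not linear. It becomes linear modulo
    the kernel, since by \<open>eq_iff\<close> the coset of a vector depends only on its value under
    \<open>T\<close>.\<close>
  define S where "S = inv_into (carrier V) T"
  have S: "S w \<in> carrier V" "T (S w) = w" if "w \<in> carrier W" for w
    using that surj by (auto simp: S_def f_inv_into_f inv_into_into)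
  have W: "vectorspace K W" by unfold_locales
  have Q: "vectorspace K ?Q"
    by (intro vectorspace.intro quotient_module_is_module M N) unfold_locales
  have "linear_map K W ?Q (\<lambda>w. ?N +>\<^bsub>V\<^esub> S w)"
  proof (intro linear_map.intro mod_hom.intro mod_hom_axioms.intro Q W vectorspace.axioms(1))
    show "(\<lambda>w. ?N +>\<^bsub>V\<^esub> S w) \<in> LinearCombinations.module_hom K W ?Q"
      unfolding LinearCombinations.module_hom_def
    proof (intro CollectI conjI allI impI Pi_I)
      show "?N +>\<^bsub>V\<^esub> S w \<in> carrier ?Q" if "w \<in> carrier W" for w
        using S that by (auto simp: carr)
      fix w w' assume "w \<in> carrier W \<and> w' \<in> carrier W"
      then show "?N +>\<^bsub>V\<^esub> S (w \<oplus>\<^bsub>W\<^esub> w') = (?N +>\<^bsub>V\<^esub> S w) \<oplus>\<^bsub>?Q\<^esub> (?N +>\<^bsub>V\<^esub> S w')"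
        by (simp add: quotient_module_def a_rcos_sum S eq_iff)
    next
      fix c w assume "c \<in> carrier K \<and> w \<in> carrier W"
      then show "?N +>\<^bsub>V\<^esub> S (c \<odot>\<^bsub>W\<^esub> w) = c \<odot>\<^bsub>?Q\<^esub> (?N +>\<^bsub>V\<^esub> S w)"
        by (simp add: quotient_module_smult_coset[OF M N] S eq_iff)
    qed
  qed
  then interpret iso: linear_map K W ?Q "\<lambda>w. ?N +>\<^bsub>V\<^esub> S w" .
  have "W.dim = vectorspace.dim K ?Q"
  proof (rule iso.dim_eq[OF fin])
    show "inj_on (\<lambda>w. ?N +>\<^bsub>V\<^esub> S w) (carrier W)"
      by (rule inj_onI) (use S eq_iff in metis)
    show "(\<lambda>w. ?N +>\<^bsub>V\<^esub> S w) ` carrier W = carrier ?Q"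
    proof (intro subset_antisym subsetI)
      fix A assume "A \<in> carrier ?Q"
      then obtain x where x: "x \<in> carrier V" "A = ?N +>\<^bsub>V\<^esub> x" by (auto simp: carr)
      then have "A = ?N +>\<^bsub>V\<^esub> S (T x)" by (simp add: S eq_iff)
      with x show "A \<in> (\<lambda>w. ?N +>\<^bsub>V\<^esub> S w) ` carrier W" by blast
    qed (use S in \<open>auto simp: carr\<close>)
  qed
  then show ?thesis by simp
qed

section \<open>Spaces of polynomials with support in a given set of monomials\<close>

definition mpolys_on :: "('v \<Rightarrow>\<^sub>0 nat) set \<Rightarrow> ('v, 'k::comm_ring_1) mpoly set" where
  "mpolys_on E = {p. Poly_Mapping.keys p \<subseteq> E}"

lemma mpolys_on_closed:
  "0 \<in> mpolys_on E"
  "p \<in> mpolys_on E \<Longrightarrow> q \<in> mpolys_on E \<Longrightarrow> p + q \<in> mpolys_on E"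
  "p \<in> mpolys_on E \<Longrightarrow> Const c * p \<in> mpolys_on E"
  using keys_add[of p q] keys_Const_mult[of c p] by (auto simp: mpolys_on_def)

lemma sum_in_mpolys_on: "(\<And>i. i \<in> A \<Longrightarrow> f i \<in> mpolys_on E) \<Longrightarrow> sum f A \<in> mpolys_on E"
  by (induction A rule: infinite_finite_induct) (auto intro: mpolys_on_closed)

text \<open>Serves twice: the degree \<open>s\<close> part of the source ring and its image in
  \<open>K[u,v]\<close> are both of this form.\<close>

lemma vectorspace_mpolys_on:
  fixes E :: "('v \<Rightarrow>\<^sub>0 nat) set"
  shows "vectorspace class_ring
    (mpoly_module\<lparr>carrier := mpolys_on E :: ('v, 'k::field) mpoly set\<rparr>)"
proof (rule vectorspace.intro)
  have M: "Module.module class_ring (mpoly_module\<lparr>carrier := UNIV :: ('v, 'k) mpoly set\<rparr>)"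
    using mpoly_module_is_module[where ?'v = 'v and ?'k = 'k] by (simp add: mpoly_module_def)
  have "Module.submodule (mpolys_on E :: ('v, 'k) mpoly set) class_ring
      (mpoly_module\<lparr>carrier := UNIV\<rparr>)"
    by (rule mpoly_submoduleI) (use M mpolys_on_closed in auto)
  from Module.submodule.submodule_is_module[OF this M]
  show "Module.module class_ring (mpoly_module\<lparr>carrier := mpolys_on E :: ('v, 'k) mpoly set\<rparr>)"
    by simp
qed (rule class_field)

lemma mpoly_sum_single:
  "finite E \<Longrightarrow> Poly_Mapping.keys p \<subseteq> E \<Longrightarrow>
    (\<Sum>e\<in>E. Poly_Mapping.single e (Poly_Mapping.lookup p e)) = p"
  by (rule poly_mapping_eqI)
    (auto simp: lookup_sum lookup_single when_def in_keys_iff if_distrib sum.delta cong: if_cong)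

text \<open>The monomials with exponent in \<open>E\<close> form a basis: the coefficient of a
  linear combination at \<open>e\<close> is the scalar placed on the monomial of
  \<open>e\<close>.\<close>

lemma dim_mpolys_on:
  fixes E :: "('v \<Rightarrow>\<^sub>0 nat) set"
  assumes E: "finite E"
  defines "M \<equiv> (mpoly_module\<lparr>carrier := mpolys_on E\<rparr> :: ('k::field, ('v, 'k) mpoly) module)"
  shows "vectorspace.fin_dim class_ring M" "vectorspace.dim class_ring M = card E"
proof -
  interpret vectorspace class_ring M
    unfolding M_def by (rule vectorspace_mpolys_on)
  define B :: "('v, 'k) mpoly set" where "B = (\<lambda>e. Poly_Mapping.single e 1) ` E"
  have inj: "inj_on (\<lambda>e. Poly_Mapping.single e (1 :: 'k)) E"
    by (rule inj_onI) (metis lookup_single_eq lookup_single_not_eq zero_neq_one)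
  have B: "finite B" "B \<subseteq> carrier M" "card B = card E"
    using E inj by (auto simp: B_def M_def mpolys_on_def card_image)
  have sum: "lincomb a A = (\<Sum>v\<in>A. Const (a v) * v)" if "finite A" "A \<subseteq> carrier M" for a A
    using that
  proof (induction A)
    case empty
    show ?case by (simp add: lincomb_def) (simp add: M_def mpoly_module_def)
  next
    case (insert x A)
    then have "lincomb a (A \<union> {x}) = a x \<odot>\<^bsub>M\<^esub> x \<oplus>\<^bsub>M\<^esub> lincomb a A"
      by (intro lincomb_insert) auto
    with insert show ?case by (simp add: M_def mpoly_module_def)
  qed
  have lc: "lincomb a B = (\<Sum>e\<in>E. Poly_Mapping.single e (a (Poly_Mapping.single e 1)))" for a
    unfolding sum[OF B(1,2)] unfolding B_def
    by (subst sum.reindex[OF inj]) (simp add: Const_def mult_single)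
  have lookup: "Poly_Mapping.lookup (lincomb a B) e = a (Poly_Mapping.single e 1)" if "e \<in> E" for a e
    using that E by (simp add: lc lookup_sum lookup_single when_def sum.delta)
  have "basis B"
    unfolding basis_def
  proof (intro conjI B(2))
    show "lin_indpt B"
    proof (rule finite_lin_indpt2[OF B(1,2)])
      fix a assume "lincomb a B = \<zero>\<^bsub>M\<^esub>"
      then show "\<forall>v\<in>B. a v = \<zero>\<^bsub>class_ring\<^esub>"
        using lookup[of _ a] by (auto simp: B_def M_def mpoly_module_def)
    qed
    show "span B = carrier M"
    proof (intro subset_antisym subsetI)
      fix p assume "p \<in> carrier M"
      then have p: "Poly_Mapping.keys p \<subseteq> E" by (simp add: M_def mpolys_on_def)
      \<comment> \<open>Scalars of \<open>lincomb\<close> are indexed by basis vectors, not by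
        exponents, so the coefficients of \<open>p\<close> are carried over along the bijection
        between \<open>E\<close> and \<open>B\<close>.\<close>
      define a where "a = Poly_Mapping.lookup p \<circ> inv_into E (\<lambda>e. Poly_Mapping.single e (1 :: 'k))"
      have "lincomb a B = p"
        unfolding lc a_def using mpoly_sum_single[OF E p] by (simp add: inv_into_f_f[OF inj])
      then show "p \<in> span B" unfolding finite_span[OF B(1,2)] by auto
    qed (use B(2) span_closed in blast)
  qed
  then show "fin_dim" "dim = card E"
    using B dim_basis[OF B(1)] by (auto simp: fin_dim_def basis_def)
qed

text \<open>On the degree \<open>s\<close> part the parametrization has kernel
  \<open>curve_ideal n m \<inter> homogeneous_part n s\<close>. The quotient thus has the dimension
  of the image, which is a number of monomials.\<close>

lemma hilbert_function_curve_ideal: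
  fixes E :: "(param \<Rightarrow>\<^sub>0 nat) set"
  assumes E: "finite E"
    and surj: "subst_vars (curve_param n m) ` homogeneous_part n s = (mpolys_on E :: (param, 'k::field) mpoly set)"
  shows "hilbert_function n (curve_ideal n m :: (nat, 'k) mpoly set) s = card E"
proof -
  let ?V = "mpoly_module\<lparr>carrier := homogeneous_part n s :: (nat, 'k) mpoly set\<rparr>"
  let ?W = "mpoly_module\<lparr>carrier := mpolys_on E :: (param, 'k) mpoly set\<rparr>"
  have H: "homogeneous_part n s =
      mpolys_on {t. Poly_Mapping.keys t \<subseteq> {1..n+1} \<and> monom_degree t = s}"
    by (auto simp: homogeneous_part_def poly_ring_def mpolys_on_def)
  have V: "vectorspace class_ring ?V" unfolding H by (rule vectorspace_mpolys_on)
  have W: "vectorspace class_ring ?W" by (rule vectorspace_mpolys_on)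
  have "subst_vars (curve_param n m) \<in> LinearCombinations.module_hom class_ring ?V ?W"
    using surj by (auto simp: LinearCombinations.module_hom_def mpoly_module_def subst_vars_add subst_vars_mult)
  then interpret linear_map class_ring ?V ?W "subst_vars (curve_param n m)"
    using V W by (intro linear_map.intro mod_hom.intro mod_hom_axioms.intro) (auto simp: vectorspace_def)
  have "mod_hom.ker = curve_ideal n m \<inter> homogeneous_part n s"
    unfolding ker_def by (auto simp: curve_ideal_def homogeneous_part_def mpoly_module_def)
  then show ?thesis
    using dim_quotient_ker[OF dim_mpolys_on(1)[OF E]] surj dim_mpolys_on(2)[OF E, where ?'k = 'k]
    by (simp add: hilbert_function_def)
qed


section \<open>Sumsets of an arithmetic sequence\<close>

text \<open>For \<open>m\<^sub>i = a + (i - 1) d\<close> and \<open>N = n - 1\<close>: the \<open>u\<close>-exponents of the monomials of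
  degree \<open>s\<close>, where \<open>j\<close> counts the factors different from \<open>x\<^sub>n\<^sub>+\<^sub>1\<close>.\<close>

definition curve_weights :: "nat \<Rightarrow> nat \<Rightarrow> nat \<Rightarrow> nat \<Rightarrow> nat set" where
  "curve_weights N a d s = (\<lambda>(j, i). j * a + i * d) ` {(j, i). j \<le> s \<and> i \<le> j * N}"

lemma curve_weights_0 [simp]: "curve_weights N a d 0 = {0}"
  by (force simp: curve_weights_def)

text \<open>If a sum \<open>(s + 1) a + i d\<close> also arises from \<open>j \<le> s\<close> terms, then \<open>d\<close> divides
  \<open>s + 1 - j\<close> by coprimality, and trading \<open>d\<close> terms for \<open>a\<close> more copies of \<open>d\<close> is already
  possible: \<open>j = s + 1 - d\<close> is the least restrictive choice.\<close>

lemma curve_weights_Suc: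
  fixes a d :: nat
  assumes "coprime a d" "a > 0" "d > 0"
  shows "curve_weights N a d (Suc s) = curve_weights N a d s \<union>
     (\<lambda>i. Suc s * a + i * d) ` {i. i \<le> Suc s * N \<and> (d \<le> Suc s \<longrightarrow> (Suc s - d) * N < i + a)}"
     (is "?L = ?R1 \<union> ?R2")
    and "curve_weights N a d s \<inter>
     (\<lambda>i. Suc s * a + i * d) ` {i. i \<le> Suc s * N \<and> (d \<le> Suc s \<longrightarrow> (Suc s - d) * N < i + a)} = {}"
proof -
  show "?L = ?R1 \<union> ?R2"
  proof (intro subset_antisym subsetI)
    fix x assume "x \<in> ?R1 \<union> ?R2"
    then show "x \<in> ?L" unfolding curve_weights_def by force
  next
    fix x assume "x \<in> ?L"
    then obtain j i where x: "x = j * a + i * d" "j \<le> Suc s" "i \<le> j * N"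
      by (auto simp: curve_weights_def)
    show "x \<in> ?R1 \<union> ?R2"
    proof (cases "j = Suc s")
      case False
      with x show ?thesis by (force simp: curve_weights_def)
    next
      case j: True
      show ?thesis
      proof (cases "d \<le> Suc s \<and> i + a \<le> (Suc s - d) * N")
        case True
        then obtain u where u: "Suc s = u + d" by (metis le_add_diff_inverse2)
        then have "x = (Suc s - d) * a + (i + a) * d"
          using x j by (simp add: algebra_simps)
        with True show ?thesis using assms(3)
          by (auto simp: curve_weights_def intro!: image_eqI[of _ _ "(Suc s - d, i + a)"])
      next
        case False
        with x j show ?thesis by auto
      qed
    qed
  qed
  show "?R1 \<inter> ?R2 = {}"
  proof -
    have False if x: "j * a + i * d = Suc s * a + i' * d" and j: "j \<le> s" "i \<le> j * N"
      and i': "d \<le> Suc s \<longrightarrow> (Suc s - d) * N < i' + a" for j i i'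
    proof -
      obtain u where u: "Suc s = j + u" using j by (metis le_add_diff_inverse le_SucI)
      then have eq: "(Suc s - j) * a + i' * d = i * d"
        using x by (simp add: algebra_simps)
      then have "d dvd (Suc s - j) * a"
        by (metis dvd_add_left_iff dvd_triv_right)
      then have "d dvd Suc s - j"
        using assms(1) by (simp add: coprime_commute coprime_dvd_mult_left_iff)
      then obtain t where t: "Suc s - j = d * t" by (elim dvdE)
      with j have "t > 0" by (cases t) auto
      from eq t have "d * (t * a + i') = d * i" by (simp add: algebra_simps)
      then have i: "t * a + i' = i" using assms(3) by simp
      \<comment> \<open>With \<open>t \<ge> 1\<close> the equation above gives
        \<open>i' + a \<le> i \<le> j * N \<le> (Suc s - d) * N\<close>, against the condition on
        \<open>i'\<close>.\<close>
      have "d \<le> d * t" using \<open>t > 0\<close> by simp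
      then have le: "j \<le> Suc s - d" "d \<le> Suc s" using t j by linarith+
      have "i' + a \<le> i" using i \<open>t > 0\<close> by (cases t) auto
      also have "\<dots> \<le> (Suc s - d) * N" using j(2) le by (meson le_trans mult_le_mono1)
      finally show False using i' le by auto
    qed
    then show ?thesis by (auto simp: curve_weights_def) 
  qed
qed

section \<open>Sizes of the sumsets\<close>

lemma finite_curve_weights [simp]: "finite (curve_weights N a d s)"
proof -
  have "finite {(j, i). j \<le> s \<and> i \<le> j * N}"
    by (rule finite_subset[of _ "{..s} \<times> {..s * N}"])
      (auto intro: le_trans mult_le_mono1)
  then show ?thesis by (simp add: curve_weights_def)
qed

text \<open>The new indices \<open>i\<close> form an interval. The shape of \<open>a\<close> means
  \<open>q * N < a \<le> (q + 1) * N\<close>, so the cutoff \<open>(s + 1 - d) * N < i + a\<close>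
  holds for every \<open>i\<close> exactly while \<open>s + 1 - d \<le> q\<close>, that is,
  \<open>s < q + d\<close>. From then on the interval has constant length \<open>a + d * N\<close>,
  which is \<open>m n\<close> for the curve.\<close>

lemma card_curve_weights_Suc:
  assumes "coprime a d" "d > 0" "a = q * N + r" "1 \<le> r" "r \<le> N"
  shows "card (curve_weights N a d (Suc s)) = card (curve_weights N a d s) +
     (if s < q + d then Suc s * N + 1 else a + d * N)"
proof -
  let ?I = "{i. i \<le> Suc s * N \<and> (d \<le> Suc s \<longrightarrow> (Suc s - d) * N < i + a)}"
  have I: "card ?I = (if s < q + d then Suc s * N + 1 else a + d * N)"
  proof (cases "s < q + d")
    case True
    have "(Suc s - d) * N < i + a" for i
    proof -
      \<comment> \<open>This includes \<open>Suc s < d\<close>, where the truncated difference is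
        0.\<close>
      have "(Suc s - d) * N \<le> q * N" using True by (intro mult_le_mono1) auto
      then show ?thesis using assms by linarith
    qed
    then have "?I = {..Suc s * N}" by auto
    then show ?thesis using True by simp
  next
    case False
    then obtain u where u: "s = q + d + u" by (metis le_add_diff_inverse not_less)
    have "(Suc s - d) * N = Suc (q + u) * N" using u by simp
    then have a: "a \<le> (Suc s - d) * N" using assms by (simp add: algebra_simps)
    have "Suc s * N = (Suc s - d) * N + d * N" using u by (simp flip: distrib_right)
    \<comment> \<open>The bound on \<open>a\<close> keeps the lower endpoint from truncating; the
      upper endpoint is \<open>Suc s * N\<close>.\<close>
    then have "?I = {(Suc s - d) * N - a <.. (Suc s - d) * N + d * N}" using a u by auto
    then show ?thesis using False a by simp
  qed
  have "inj_on (\<lambda>i. Suc s * a + i * d) ?I" using assms(2) by (simp add: inj_on_def)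
  then have J: "card ((\<lambda>i. Suc s * a + i * d) ` ?I) = card ?I" by (rule card_image)
  have "a > 0" using assms by simp
  note W = curve_weights_Suc[OF assms(1) this assms(2), where N = N and s = s]
  have "finite ?I" by simp
  then show ?thesis
    unfolding W(1) I[symmetric] J[symmetric]
    by (intro card_Un_disjoint W(2) finite_curve_weights finite_imageI)
qed

text \<open>Summation of the increments, doubled and over the integers so that triangular numbers
  need no division. The two formulas agree at \<open>s = q + d\<close>, where the second induction
  starts.\<close>

lemma card_curve_weights:
  assumes "coprime a d" "d > 0" "a = q * N + r" "1 \<le> r" "r \<le> N"
  shows "s \<le> q + d \<Longrightarrow>
      2 * int (card (curve_weights N a d s)) = int s * (int s + 1) * int N + 2 * int s + 2"
    and "s \<ge> q + d \<Longrightarrow>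
      2 * int (card (curve_weights N a d s)) = int (q + d) * (int (q + d) + 1) * int N +
        2 * int (q + d) + 2 + 2 * (int s - int (q + d)) * int (a + d * N)"
proof -
  have *: "2 * int (card (curve_weights N a d s)) = int s * (int s + 1) * int N + 2 * int s + 2"
    if "s \<le> q + d" for s
    using that
  proof (induction s)
    case (Suc s)
    then have IH: "2 * int (card (curve_weights N a d s)) =
        int s * (int s + 1) * int N + 2 * int s + 2" by simp
    have "card (curve_weights N a d (Suc s)) = card (curve_weights N a d s) + Suc s * N + 1"
      using Suc.prems by (simp only: card_curve_weights_Suc[OF assms]) simp
    then have "2 * int (card (curve_weights N a d (Suc s))) =
        2 * int (card (curve_weights N a d s)) + 2 * ((1 + int s) * int N + 1)"
      by (simp add: distrib_right)
    then show ?case unfolding IH by (simp add: distrib_left distrib_right)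
  qed simp
  then show "s \<le> q + d \<Longrightarrow>
      2 * int (card (curve_weights N a d s)) = int s * (int s + 1) * int N + 2 * int s + 2" .
  assume "s \<ge> q + d"
  then show "2 * int (card (curve_weights N a d s)) = int (q + d) * (int (q + d) + 1) * int N +
        2 * int (q + d) + 2 + 2 * (int s - int (q + d)) * int (a + d * N)"
  proof (induction s rule: dec_induct)
    case (step s)
    have "card (curve_weights N a d (Suc s)) = card (curve_weights N a d s) + (a + d * N)"
      using step.hyps by (simp only: card_curve_weights_Suc[OF assms]) simp
    then have "2 * int (card (curve_weights N a d (Suc s))) =
        2 * int (card (curve_weights N a d s)) + 2 * int (a + d * N)"
      by simp
    also have "\<dots> = int (q + d) * (int (q + d) + 1) * int N + 2 * int (q + d) + 2 +
        2 * (int (Suc s) - int (q + d)) * int (a + d * N)"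
      unfolding step.IH by (simp add: distrib_left distrib_right left_diff_distrib del: of_nat_add)
    finally show ?case .
  qed (use *[of "q + d"] in simp)
qed

section \<open>Comparison with the binomial formula\<close>

lemma two_times_choose_2: "2 * int (Suc x choose 2) = int (x + 1) * int x"
proof -
  have "2 * (Suc x choose 2) = (x + 1) * x" by (simp add: choose_two)
  then show ?thesis by (metis of_nat_mult of_nat_numeral)
qed

text \<open>Doubling turns the binomial coefficients into polynomials, and each case becomes a
  polynomial identity that matches \<open>card_curve_weights\<close>.\<close>

lemma card_curve_weights_eq:
  assumes "coprime a d" "d > 0" "a = q * (n - 1) + r" "1 \<le> r" "r \<le> n - 1" "n \<ge> 2"
  shows "int (card (curve_weights (n - 1) a d s)) =
    (if s < q + d
     then int ((s + 2) choose 2) + (int n - 2) * int ((s + 1) choose 2)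
     else int (a + (n - 1) * d) * int s + int (q + d) * (2 - int n + int (n - r))
       - int ((q + d + 1) choose 2) - (int n - 2) * int ((q + d) choose 2) + 1)"
proof -
  define z where "z = q + d"
  have ch: "2 * int ((x + 2) choose 2) = (int x + 2) * (int x + 1)"
       "2 * int ((x + 1) choose 2) = (int x + 1) * int x"
       "2 * int (x choose 2) = int x * (int x - 1)" for x
    using two_times_choose_2[of "x + 1"] two_times_choose_2[of "x"] two_times_choose_2[of "x - 1"]
    by (cases x; simp add: algebra_simps)+
  obtain N where n: "n = Suc N" using assms by (cases n) auto
  have a: "int a = int q * int N + int r" using assms n by simp
  have r: "int (n - r) = int N + 1 - int r" using assms n by (simp add: of_nat_diff)
  note c = card_curve_weights[OF assms(1-5), of s, folded z_def]
  show ?thesis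
  proof (cases "s < z")
    case True
    let ?P = "int ((s + 2) choose 2)" and ?Q = "int ((s + 1) choose 2)"
    have "2 * (?P + (int n - 2) * ?Q) = 2 * ?P + (int n - 2) * (2 * ?Q)"
      by (simp only: distrib_left left_diff_distrib right_diff_distrib)
    also have "\<dots> = int s * (int s + 1) * int (n - 1) + 2 * int s + 2"
      unfolding ch n by (simp add: algebra_simps)
    also have "\<dots> = 2 * int (card (curve_weights (n - 1) a d s))"
      using c(1) True by simp
    finally show ?thesis using True by (simp only: z_def) simp
  next
    case False
    let ?P = "int ((z + 1) choose 2)" and ?Q = "int (z choose 2)"
      and ?X = "int (a + (n - 1) * d) * int s + int z * (2 - int n + int (n - r))"
    have "2 * (?X - ?P - (int n - 2) * ?Q + 1) = 2 * ?X - 2 * ?P - (int n - 2) * (2 * ?Q) + 2"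
      by (simp only: distrib_left right_diff_distrib left_diff_distrib)
    also have "\<dots> = int z * (int z + 1) * int (n - 1) +
        2 * int z + 2 + 2 * (int s - int z) * int (a + d * (n - 1))"
      \<comment> \<open>With \<open>N = n - 1\<close>, the two sides differ by
        \<open>2 * z * (a - r - N * (z - d))\<close>, which vanishes since \<open>z = q + d\<close>
        and \<open>a = q * N + r\<close>.\<close>
      unfolding ch r z_def of_nat_add of_nat_mult a by (simp add: n algebra_simps)
    also have "\<dots> = 2 * int (card (curve_weights (n - 1) a d s))"
      using c(2) False by simp
    finally show ?thesis using False by (simp only: z_def) simp
  qed
qed


section \<open>The Hilbert function of the curve\<close>

definition uv_exponent :: "nat \<Rightarrow> nat \<Rightarrow> param \<Rightarrow>\<^sub>0 nat" where
  "uv_exponent a b = Poly_Mapping.single U a + Poly_Mapping.single V b"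

lemma uv_exponent_add: "uv_exponent a b + uv_exponent a' b' = uv_exponent (a + a') (b + b')"
  by (simp add: uv_exponent_def single_add add_ac)

lemma uv_exponent_inject [simp]: "uv_exponent a b = uv_exponent a' b' \<longleftrightarrow> a = a' \<and> b = b'"
proof
  assume eq: "uv_exponent a b = uv_exponent a' b'"
  have "Poly_Mapping.lookup (uv_exponent a b) U = a" "Poly_Mapping.lookup (uv_exponent a b) V = b" for a b
    by (simp_all add: uv_exponent_def lookup_add lookup_single)
  with eq show "a = a' \<and> b = b'" by metis
qed simp

lemma single_uv_exponent_power:
  "Poly_Mapping.single (uv_exponent a b) (1 :: 'k::comm_ring_1) ^ k =
    Poly_Mapping.single (uv_exponent (k * a) (k * b)) 1"
proof (induction k)
  case 0
  show ?case by (simp add: uv_exponent_def)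
qed (simp add: mult_single uv_exponent_add)

lemma prod_single_uv_exponent:
  "(\<Prod>i\<in>A. Poly_Mapping.single (uv_exponent (f i) (g i)) (1 :: 'k::comm_ring_1)) =
    Poly_Mapping.single (uv_exponent (sum f A) (sum g A)) 1"
  by (induction A rule: infinite_finite_induct)
    (simp_all add: mult_single uv_exponent_add, simp_all add: uv_exponent_def)

lemma Var_power: "Var i ^ k = Poly_Mapping.single (Poly_Mapping.single i k) (1 :: 'k::comm_ring_1)"
  by (induction k) (simp_all add: Var_def mult_single single_add[symmetric])

text \<open>Giving the last variable weight 0 makes all variables uniform: one of weight
  \<open>w\<close> is sent to the monomial with exponents \<open>w\<close> and
  \<open>m n - w\<close>.\<close>

lemma curve_param_eq_single:
  "curve_param n m i = Poly_Mapping.single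
     (uv_exponent (if i \<le> n then m i else 0) (m n - (if i \<le> n then m i else 0))) (1 :: 'k::comm_ring_1)"
  by (simp add: curve_param_def Var_power mult_single uv_exponent_def)

definition curve_weight :: "nat \<Rightarrow> (nat \<Rightarrow> nat) \<Rightarrow> (nat \<Rightarrow>\<^sub>0 nat) \<Rightarrow> nat" where
  "curve_weight n m t = (\<Sum>i\<in>Poly_Mapping.keys t. Poly_Mapping.lookup t i * (if i \<le> n then m i else 0))"

text \<open>The \<open>v\<close>-exponent is a sum of differences \<open>m n - w\<close> over the
  factors. No weight exceeds \<open>m n\<close>, so nothing truncates and the sum splits.\<close>

lemma subst_vars_curve_param_single:
  fixes c :: "'k::comm_ring_1"
  assumes "\<And>i. i \<in> {1..n} \<Longrightarrow> m i \<le> m n" "Poly_Mapping.keys t \<subseteq> {1..n+1}"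
  shows "subst_vars (curve_param n m) (Poly_Mapping.single t c) = Poly_Mapping.single
    (uv_exponent (curve_weight n m t) (monom_degree t * m n - curve_weight n m t)) c"
proof -
  let ?w = "\<lambda>i. if i \<le> n then m i else 0" and ?t = "Poly_Mapping.lookup t"
  have w: "?w i \<le> m n" if "i \<in> Poly_Mapping.keys t" for i
    using assms that by (cases "i \<le> n") force+
  have "(\<Sum>i\<in>Poly_Mapping.keys t. ?t i * (m n - ?w i)) =
      (\<Sum>i\<in>Poly_Mapping.keys t. ?t i * m n - ?t i * ?w i)"
    by (simp add: right_diff_distrib')
  also have "\<dots> = (\<Sum>i\<in>Poly_Mapping.keys t. ?t i * m n) - (\<Sum>i\<in>Poly_Mapping.keys t. ?t i * ?w i)"
    by (rule sum_subtractf_nat) (use w in \<open>intro mult_le_mono2\<close>)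
  also have "\<dots> = monom_degree t * m n - curve_weight n m t"
    by (simp add: monom_degree_def curve_weight_def sum_distrib_right)
  finally show ?thesis
    by (simp add: subst_vars_single curve_param_eq_single single_uv_exponent_power
      prod_single_uv_exponent Const_def mult_single curve_weight_def)
qed

text \<open>Monomials go to monomials, and within degree \<open>s\<close> the image depends only on
  the weight. Hence the image is spanned by one monomial for each weight that occurs.\<close>

lemma subst_vars_image_homogeneous_part:
  fixes n s m
  assumes m: "\<And>i. i \<in> {1..n} \<Longrightarrow> m i \<le> m n"
  defines "S \<equiv> curve_weight n m ` {t. Poly_Mapping.keys t \<subseteq> {1..n+1} \<and> monom_degree t = s}"
  shows "subst_vars (curve_param n m) ` homogeneous_part n s =
    (mpolys_on ((\<lambda>w. uv_exponent w (s * m n - w)) ` S) :: (param, 'k::comm_ring_1) mpoly set)"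
proof (intro subset_antisym subsetI)
  let ?E = "(\<lambda>w. uv_exponent w (s * m n - w)) ` S"
  let ?f = "curve_param n m :: nat \<Rightarrow> (param, 'k) mpoly"
  fix p :: "(param, 'k) mpoly"
  {
    assume "p \<in> subst_vars ?f ` homogeneous_part n s"
    then obtain q :: "(nat, 'k) mpoly" where q: "q \<in> homogeneous_part n s" "p = subst_vars ?f q" by blast
    have "p = subst_vars ?f (\<Sum>t\<in>Poly_Mapping.keys q. Poly_Mapping.single t (Poly_Mapping.lookup q t))"
      using q by (simp add: mpoly_sum_single)
    also have "\<dots> = (\<Sum>t\<in>Poly_Mapping.keys q. subst_vars ?f (Poly_Mapping.single t (Poly_Mapping.lookup q t)))"
      by (rule sum_comp_morphism[unfolded comp_def, symmetric]) (simp_all add: subst_vars_add)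
    also have "\<dots> \<in> mpolys_on ?E"
    proof (rule sum_in_mpolys_on)
      fix t assume "t \<in> Poly_Mapping.keys q"
      with q have t: "Poly_Mapping.keys t \<subseteq> {1..n+1}" "monom_degree t = s"
        by (auto simp: homogeneous_part_def poly_ring_def)
      then have "uv_exponent (curve_weight n m t) (s * m n - curve_weight n m t) \<in> ?E"
        unfolding S_def by blast
      then show "subst_vars ?f (Poly_Mapping.single t (Poly_Mapping.lookup q t)) \<in> mpolys_on ?E"
        by (simp only: subst_vars_curve_param_single[of n m, OF m t(1)] t(2)) (simp add: mpolys_on_def)
    qed
    finally show "p \<in> mpolys_on ?E" .
  next
    assume "p \<in> mpolys_on ?E"
    then have p: "Poly_Mapping.keys p \<subseteq> ?E" by (simp add: mpolys_on_def)
    have "\<exists>t. Poly_Mapping.keys t \<subseteq> {1..n+1} \<and> monom_degree t = s \<and>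
        uv_exponent (curve_weight n m t) (s * m n - curve_weight n m t) = e"
      if "e \<in> Poly_Mapping.keys p" for e
      using that p by (auto simp: S_def)
    \<comment> \<open>Several monomials may have the same image; a single preimage
      \<open>t e\<close> is chosen for each exponent \<open>e\<close>.\<close>
    then obtain t where t: "Poly_Mapping.keys (t e) \<subseteq> {1..n+1}" "monom_degree (t e) = s"
        "uv_exponent (curve_weight n m (t e)) (s * m n - curve_weight n m (t e)) = e"
      if "e \<in> Poly_Mapping.keys p" for e
      by metis
    define q where "q = (\<Sum>e\<in>Poly_Mapping.keys p. Poly_Mapping.single (t e) (Poly_Mapping.lookup p e))"
    have "q \<in> mpolys_on {t. Poly_Mapping.keys t \<subseteq> {1..n+1} \<and> monom_degree t = s}"
      unfolding q_def by (rule sum_in_mpolys_on) (use t in \<open>auto simp: mpolys_on_def\<close>)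
    then have "q \<in> homogeneous_part n s"
      by (auto simp: homogeneous_part_def poly_ring_def mpolys_on_def)
    have "subst_vars ?f q =
        (\<Sum>e\<in>Poly_Mapping.keys p. subst_vars ?f (Poly_Mapping.single (t e) (Poly_Mapping.lookup p e)))"
      unfolding q_def by (rule sum_comp_morphism[unfolded comp_def, symmetric]) (simp_all add: subst_vars_add)
    moreover have "subst_vars ?f (Poly_Mapping.single (t e) (Poly_Mapping.lookup p e)) =
        Poly_Mapping.single e (Poly_Mapping.lookup p e)" if "e \<in> Poly_Mapping.keys p" for e
      by (simp only: subst_vars_curve_param_single[of n m, OF m t(1)[OF that]] t(2,3)[OF that])
    ultimately have "subst_vars ?f q = p"
      using mpoly_sum_single[of "Poly_Mapping.keys p" p] by simp
    with \<open>q \<in> homogeneous_part n s\<close> show "p \<in> subst_vars ?f ` homogeneous_part n s" by blast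
  }
qed

section \<open>Weights of the monomials of degree \<open>s\<close>\<close>

lemma monom_degree_superset:
  "finite A \<Longrightarrow> Poly_Mapping.keys t \<subseteq> A \<Longrightarrow> monom_degree t = (\<Sum>i\<in>A. Poly_Mapping.lookup t i)"
  unfolding monom_degree_def by (rule sum.mono_neutral_left) (auto simp: in_keys_iff)

lemma curve_weight_superset:
  "finite A \<Longrightarrow> Poly_Mapping.keys t \<subseteq> A \<Longrightarrow>
    curve_weight n m t = (\<Sum>i\<in>A. Poly_Mapping.lookup t i * (if i \<le> n then m i else 0))"
  unfolding curve_weight_def by (rule sum.mono_neutral_left) (auto simp: in_keys_iff)

text \<open>A factor \<open>x_i\<close> with \<open>i \<le> n\<close> contributes \<open>a\<close>
  once and \<open>d\<close> exactly \<open>i - 1\<close> times. Conversely, a monomial of prescribed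
  weight is built one variable at a time.\<close>

lemma curve_weights_eq_image:
  assumes m: "\<And>i. i \<in> {1..n} \<Longrightarrow> m i = a + (i - 1) * d" and "n \<ge> 1"
  shows "curve_weight n m ` {t. Poly_Mapping.keys t \<subseteq> {1..n+1} \<and> monom_degree t = s} =
    curve_weights (n - 1) a d s"
proof (intro subset_antisym subsetI)
  fix w assume "w \<in> curve_weight n m ` {t. Poly_Mapping.keys t \<subseteq> {1..n+1} \<and> monom_degree t = s}"
  then obtain t where t: "Poly_Mapping.keys t \<subseteq> {1..n+1}" "monom_degree t = s" "w = curve_weight n m t"
    by blast
  let ?t = "Poly_Mapping.lookup t"
  \<comment> \<open>\<open>j\<close> counts the factors other than the last variable, and
    \<open>e\<close> adds up their multiples of \<open>d\<close>.\<close>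
  define j where "j = (\<Sum>i=1..n. ?t i)"
  define e where "e = (\<Sum>i=1..n. ?t i * (i - 1))"
  have "s = j + ?t (n + 1)"
    using monom_degree_superset[OF _ t(1)] t(2) by (simp add: j_def)
  moreover have "e \<le> j * (n - 1)"
    unfolding j_def e_def sum_distrib_right by (intro sum_mono mult_le_mono2) auto
  moreover have "w = (\<Sum>i=1..n. ?t i * (a + (i - 1) * d))"
    using curve_weight_superset[OF _ t(1), of n m] t(3) m by (simp del: mult_eq_if)
  then have "w = j * a + e * d"
    by (simp add: j_def e_def sum_distrib_right distrib_left sum.distrib mult.assoc)
  ultimately show "w \<in> curve_weights (n - 1) a d s"
    by (auto simp: curve_weights_def intro!: image_eqI[of _ _ "(j, e)"])
next
  have add_var: "Poly_Mapping.keys (t + Poly_Mapping.single i 1) \<subseteq> {1..n+1}"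
      "monom_degree (t + Poly_Mapping.single i 1) = Suc (monom_degree t)"
      "curve_weight n m (t + Poly_Mapping.single i 1) = curve_weight n m t + (if i \<le> n then m i else 0)"
    if "Poly_Mapping.keys t \<subseteq> {1..n+1}" "i \<in> {1..n+1}" for t i
  proof -
    show k: "Poly_Mapping.keys (t + Poly_Mapping.single i 1) \<subseteq> {1..n+1}"
      using that keys_add[of t "Poly_Mapping.single i 1"] by auto
    show "monom_degree (t + Poly_Mapping.single i 1) = Suc (monom_degree t)"
      using that(2) unfolding monom_degree_superset[OF finite_atLeastAtMost k]
        monom_degree_superset[OF finite_atLeastAtMost that(1)] lookup_add sum.distrib
      by (simp add: lookup_single when_def del: sum.cl_ivl_Suc)
    show "curve_weight n m (t + Poly_Mapping.single i 1) = curve_weight n m t + (if i \<le> n then m i else 0)"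
      using that(2) unfolding curve_weight_superset[OF finite_atLeastAtMost k]
          curve_weight_superset[OF finite_atLeastAtMost that(1)] lookup_add distrib_right sum.distrib
      by (simp add: lookup_single when_def if_distrib[of "\<lambda>x. x * _"] del: sum.cl_ivl_Suc cong: if_cong)
  qed
  have ex: "\<exists>t. Poly_Mapping.keys t \<subseteq> {1..n+1} \<and> monom_degree t = s \<and> curve_weight n m t = j * a + i * d"
    if "j \<le> s" "i \<le> j * (n - 1)" for i j
    using that
  proof (induction s arbitrary: i j)
    case 0
    then show ?case by (auto simp: monom_degree_def curve_weight_def intro!: exI[of _ 0])
  next
    case (Suc s)
    show ?case
    proof (cases j)
      case 0
      \<comment> \<open>Here \<open>i = 0\<close> is forced, and the degree is filled up with the
        last variable, of weight 0.\<close>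
      with Suc.IH[of 0 0] obtain t where t: "Poly_Mapping.keys t \<subseteq> {1..n+1}" "monom_degree t = s"
        "curve_weight n m t = 0" by auto
      have n: "n + 1 \<in> {1..n+1}" by simp
      show ?thesis
        using add_var[OF t(1) n] t 0 Suc.prems by (intro exI[of _ "t + Poly_Mapping.single (n + 1) 1"]) auto
    next
      case (Suc j')
      \<comment> \<open>Greedy choice: taking as many copies of \<open>d\<close> as one variable
        allows leaves at most \<open>j' * (n - 1)\<close> for the other \<open>j'\<close> factors.
        The variable with \<open>i0\<close> copies has index \<open>i0 + 1\<close>.\<close>
      define i0 where "i0 = min i (n - 1)"
      have "j' \<le> s" "i - i0 \<le> j' * (n - 1)" using Suc Suc.prems by (auto simp: i0_def min_def)
      from Suc.IH[OF this] obtain t where t: "Poly_Mapping.keys t \<subseteq> {1..n+1}" "monom_degree t = s"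
        "curve_weight n m t = j' * a + (i - i0) * d" by auto
      have i0: "i0 + 1 \<in> {1..n+1}" "i0 + 1 \<le> n" "i0 \<le> i" using \<open>n \<ge> 1\<close> by (auto simp: i0_def)
      then have "i * d = (i - i0) * d + i0 * d" by (simp flip: distrib_right)
      then show ?thesis
        using add_var[OF t(1) i0(1)] t i0(2) Suc m[of "i0 + 1"]
        by (intro exI[of _ "t + Poly_Mapping.single (i0 + 1) 1"]) auto
    qed
  qed
  fix w assume "w \<in> curve_weights (n - 1) a d s"
  then obtain j i where "j \<le> s" "i \<le> j * (n - 1)" and w: "w = j * a + i * d"
    by (auto simp: curve_weights_def)
  then obtain t where "Poly_Mapping.keys t \<subseteq> {1..n+1}" "monom_degree t = s"
      "curve_weight n m t = w"
    using ex[of j i] by auto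
  then show "w \<in> curve_weight n m ` {t. Poly_Mapping.keys t \<subseteq> {1..n+1} \<and> monom_degree t = s}"
    by blast
qed

theorem theorem2p11:
  fixes m :: "nat \<Rightarrow> nat" and n d q r \<alpha> k :: nat
  assumes "infinite (UNIV :: 'k::field set)"
    and "n \<ge> 2" and "m 1 > 0" and "d > 0"
    and "\<forall>i\<in>{1..n}. m i = m 1 + (i - 1) * d"
    and "gcd (m 1) d = 1"
    and "r \<in> {1..n-1}" and "m 1 = q * (n - 1) + r"
    and "\<alpha> = q + d" and "k = n - r"
  shows "\<forall>s::nat. int (hilbert_function n (curve_ideal n m :: (nat, 'k) mpoly set) s) =
    (if s < \<alpha>
     then int ((s + 2) choose 2) + (int n - 2) * int ((s + 1) choose 2)
     else int (m n) * int s + int \<alpha> * (2 - int n + int k)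
       - int ((\<alpha> + 1) choose 2) - (int n - 2) * int (\<alpha> choose 2) + 1)"
proof
  fix s
  have m: "m i = m 1 + (i - 1) * d" if "i \<in> {1..n}" for i using assms(5) that by blast
  have mn: "m n = m 1 + (n - 1) * d" using m[of n] assms(2) by simp
  have le: "m i \<le> m n" if "i \<in> {1..n}" for i
  proof -
    have "(i - 1) * d \<le> (n - 1) * d" using that by (intro mult_le_mono1) auto
    then show ?thesis using m[OF that] mn by linarith
  qed
  have cop: "coprime (m 1) d" using assms(6) by (simp add: coprime_iff_gcd_eq_1)
  have r: "1 \<le> r" "r \<le> n - 1" using assms(7) by auto
  let ?S = "curve_weights (n - 1) (m 1) d s"
  let ?E = "(\<lambda>w. uv_exponent w (s * m n - w)) ` ?S"
  have S: "curve_weight n m ` {t. Poly_Mapping.keys t \<subseteq> {1..n+1} \<and> monom_degree t = s} = ?S"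
    by (rule curve_weights_eq_image, erule m) (use assms(2) in simp)
  have "hilbert_function n (curve_ideal n m :: (nat, 'k) mpoly set) s = card ?E"
    by (rule hilbert_function_curve_ideal[OF _ subst_vars_image_homogeneous_part[of n m, OF le, where s = s, unfolded S]])
      simp_all
  \<comment> \<open>Distinct weights already differ in the exponent of \<open>u\<close>.\<close>
  also have "card ?E = card ?S" by (rule card_image) (simp add: inj_on_def)
  finally show "int (hilbert_function n (curve_ideal n m :: (nat, 'k) mpoly set) s) =
    (if s < \<alpha>
     then int ((s + 2) choose 2) + (int n - 2) * int ((s + 1) choose 2)
     else int (m n) * int s + int \<alpha> * (2 - int n + int k)
       - int ((\<alpha> + 1) choose 2) - (int n - 2) * int (\<alpha> choose 2) + 1)"
    unfolding mn \<open>\<alpha> = q + d\<close> \<open>k = n - r\<close>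
    using card_curve_weights_eq[OF cop \<open>d > 0\<close> \<open>m 1 = q * (n - 1) + r\<close> r \<open>n \<ge> 2\<close>] by (simp only:)
qed

end
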